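(* Let $X$ be a locally connected continuum and let $f:X\to X$ be a continuous surjective map. Then for every $x\in X$ the set $S_{eq}(x)$ is connected. In particular, $(X,f)$ is semi-conjugated to its maximal equicontinuous factor via a monotone map.
   Context: A continuum is a non-empty compact connected metric space. A dynamical system $(X,f)$ is a compact metric space $X$ with a continuous map $f:X\to X$. A factor map $\pi:(X,f)\to(Y,g)$ is a continuous surjection $\pi:X\to Y$ with $\pi\circ f=g\circ\pi$; then $(Y,g)$ is called a factor of $(X,f)$, and $(X,f)$ is said to be semi-conjugated to $(Y,g)$ via $\pi$. A system $(Y,g)$ with $g$ a homeomorphism is equicontinuous if the family $\{g^n: n\in\mathbb{Z}\}$ is equicontinuous. The maximal equicontinuous factor of $(X,f)$ is an equicontinuous factor of $(X,f)$ such that every equicontinuous factor of $(X,f)$ is a factor of it. $S_{eq}(X,f)\subset X\times X$ denotes the equivalence relation on $X$ whose induced quotient system is the maximal equicontinuous factor, i.e. the smallest closed $f\times f$-invariant equivalence relation whose quotient system is equicontinuous. For $x\in X$, $S_{eq}(x)=\{y\in X:(x,y)\in S_{eq}(X,f)\}$. A map is monotone if the preimage of every connected subset is connected. *)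

theory Defs
  imports "HOL-Analysis.Analysis"
begin

text \<open>
  Systems are carried by abstract topologies, so that a subset of a metric space and a space of
  equivalence classes are treated alike. Only the values of a map on the carrier matter.
\<close>

definition dynamical_system :: "'a topology \<Rightarrow> ('a \<Rightarrow> 'a) \<Rightarrow> bool" where
  "dynamical_system T f \<longleftrightarrow> compact_space T \<and> metrizable_space T \<and> continuous_map T T f"

definition factor_map ::
    "'a topology \<Rightarrow> ('a \<Rightarrow> 'a) \<Rightarrow> 'b topology \<Rightarrow> ('b \<Rightarrow> 'b) \<Rightarrow> ('a \<Rightarrow> 'b) \<Rightarrow> bool" where
  "factor_map T f U g \<pi> \<longleftrightarrow>
     continuous_map T U \<pi> \<and> \<pi> ` topspace T = topspace U \<and>
     (\<forall>x\<in>topspace T. \<pi> (f x) = g (\<pi> x))"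

definition is_factor ::
    "'a topology \<Rightarrow> ('a \<Rightarrow> 'a) \<Rightarrow> 'b topology \<Rightarrow> ('b \<Rightarrow> 'b) \<Rightarrow> bool" where
  "is_factor T f U g \<longleftrightarrow> dynamical_system U g \<and> (\<exists>\<pi>. factor_map T f U g \<pi>)"

definition int_iterate :: "'a set \<Rightarrow> ('a \<Rightarrow> 'a) \<Rightarrow> int \<Rightarrow> 'a \<Rightarrow> 'a" where
  "int_iterate S g n =
     (if 0 \<le> n then g ^^ nat n else inv_into S g ^^ nat (- n))"

text \<open>
  Equicontinuity of the family of all integer iterates does not depend on the choice of the
  compatible metric, and its pointwise and uniform versions agree, because the space is compact.
\<close>

definition equicontinuous_system :: "'a topology \<Rightarrow> ('a \<Rightarrow> 'a) \<Rightarrow> bool" where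
  "equicontinuous_system T g \<longleftrightarrow>
     dynamical_system T g \<and> homeomorphic_map T T g \<and>
     (\<exists>d. Metric_space (topspace T) d \<and> Metric_space.mtopology (topspace T) d = T \<and>
          (\<forall>x\<in>topspace T. \<forall>e>0. \<exists>\<delta>>0. \<forall>y\<in>topspace T. d x y < \<delta> \<longrightarrow>
             (\<forall>n. d (int_iterate (topspace T) g n x) (int_iterate (topspace T) g n y) < e)))"

text \<open>
  The type argument fixes the type carrying the competing factors. In a theorem it is left as a
  type variable, so that factors on every type are covered.
\<close>

definition maximal_equicontinuous_factor ::
    "'c itself \<Rightarrow> 'a topology \<Rightarrow> ('a \<Rightarrow> 'a) \<Rightarrow> 'b topology \<Rightarrow> ('b \<Rightarrow> 'b) \<Rightarrow> bool" where
  "maximal_equicontinuous_factor _ T f U g \<longleftrightarrow>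
     is_factor T f U g \<and> equicontinuous_system U g \<and>
     (\<forall>(V :: 'c topology) h. is_factor T f V h \<and> equicontinuous_system V h \<longrightarrow> is_factor U g V h)"

definition quotient_topology :: "'a topology \<Rightarrow> ('a \<times> 'a) set \<Rightarrow> 'a set topology" where
  "quotient_topology T R =
     topology (\<lambda>V. V \<subseteq> topspace T // R \<and> openin T {x \<in> topspace T. R `` {x} \<in> V})"

lemma openin_quotient_topology:
  "openin (quotient_topology T R) V \<longleftrightarrow>
     V \<subseteq> topspace T // R \<and> openin T {x \<in> topspace T. R `` {x} \<in> V}"
proof -
  have "istopology (\<lambda>V. V \<subseteq> topspace T // R \<and> openin T {x \<in> topspace T. R `` {x} \<in> V})"
    unfolding istopology_def
  proof (intro conjI allI impI; (elim conjE)?)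
    fix V W
    assume "openin T {x \<in> topspace T. R `` {x} \<in> V}" "openin T {x \<in> topspace T. R `` {x} \<in> W}"
    moreover have "{x \<in> topspace T. R `` {x} \<in> V \<inter> W} =
        {x \<in> topspace T. R `` {x} \<in> V} \<inter> {x \<in> topspace T. R `` {x} \<in> W}" by blast
    ultimately show "openin T {x \<in> topspace T. R `` {x} \<in> V \<inter> W}" by auto
  next
    fix \<K>
    assume "\<forall>V\<in>\<K>. V \<subseteq> topspace T // R \<and> openin T {x \<in> topspace T. R `` {x} \<in> V}"
    moreover have "{x \<in> topspace T. R `` {x} \<in> \<Union>\<K>} =
        \<Union>((\<lambda>V. {x \<in> topspace T. R `` {x} \<in> V}) ` \<K>)" by blast
    ultimately show "openin T {x \<in> topspace T. R `` {x} \<in> \<Union>\<K>}" by auto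
  qed auto
  then show ?thesis
    by (simp add: quotient_topology_def)
qed

lemma topspace_quotient_topology: "topspace (quotient_topology T R) = topspace T // R"
proof -
  have "{x \<in> topspace T. R `` {x} \<in> topspace T // R} = topspace T"
    by (auto simp: quotient_def)
  then have "openin (quotient_topology T R) (topspace T // R)"
    by (simp add: openin_quotient_topology)
  then show ?thesis
    by (metis openin_quotient_topology openin_subset openin_topspace subset_antisym)
qed

lemma quotient_map_quotient_topology:
  "quotient_map T (quotient_topology T R) (\<lambda>x. R `` {x})"
  by (auto simp: quotient_map_def topspace_quotient_topology openin_quotient_topology quotient_def)

definition induced_map :: "('a \<times> 'a) set \<Rightarrow> ('a \<Rightarrow> 'a) \<Rightarrow> 'a set \<Rightarrow> 'a set" where
  "induced_map R f C = R `` (f ` C)"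

definition closed_invariant_equiv :: "'a topology \<Rightarrow> ('a \<Rightarrow> 'a) \<Rightarrow> ('a \<times> 'a) set \<Rightarrow> bool" where
  "closed_invariant_equiv T f R \<longleftrightarrow>
     equiv (topspace T) R \<and> closedin (prod_topology T T) R \<and> map_prod f f ` R \<subseteq> R"

lemma induced_map_class:
  assumes "closed_invariant_equiv T f R" "x \<in> topspace T"
  shows "induced_map R f (R `` {x}) = R `` {f x}"
proof -
  have R: "equiv (topspace T) R" and inv: "\<And>a b. (a, b) \<in> R \<Longrightarrow> (f a, f b) \<in> R"
    using assms(1) by (auto simp: closed_invariant_equiv_def)
  have "(x, x) \<in> R"
    using R assms(2) by (simp add: equiv_def refl_on_def)
  moreover have "R `` {f y} = R `` {f x}" if "(x, y) \<in> R" for y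
    using equiv_class_eq[OF R inv[OF that]] by simp
  ultimately show ?thesis
    unfolding induced_map_def by blast
qed

definition S_eq :: "'a topology \<Rightarrow> ('a \<Rightarrow> 'a) \<Rightarrow> ('a \<times> 'a) set" where
  "S_eq T f = (LEAST R. closed_invariant_equiv T f R \<and>
     equicontinuous_system (quotient_topology T R) (induced_map R f))"

text \<open>
  The library's \<^const>\<open>monotone_map\<close> only asks the fibres to be connected, so it is not used here.
\<close>

definition monotone_mapping :: "'a topology \<Rightarrow> 'b topology \<Rightarrow> ('a \<Rightarrow> 'b) \<Rightarrow> bool" where
  "monotone_mapping T U \<pi> \<longleftrightarrow>
     (\<forall>C. connectedin U C \<longrightarrow> connectedin T {x \<in> topspace T. \<pi> x \<in> C})"

end

theory Submission
  imports Defs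
begin

text \<open>
  Equicontinuous factors of a surjective system \<open>(X, f)\<close> on a compact metric space correspond to
  continuous pseudometrics \<open>\<rho>\<close> on \<open>X\<close> with \<open>\<rho> (f x) (f y) = \<rho> x y\<close>. A factor map \<open>\<pi>\<close> onto
  \<open>(V, h)\<close> yields the pseudometric \<open>sup\<^sub>n min 1 (d (h\<^sup>n (\<pi> x)) (h\<^sup>n (\<pi> y)))\<close>, whose zero set is the
  kernel of \<open>\<pi>\<close> (\<open>equicontinuous_factor_imp_invariant_pseudometric\<close>); conversely, \<open>f\<close> induces a
  surjective isometry on the metric quotient of \<open>X\<close> by the zero set of \<open>\<rho>\<close>
  (\<open>invariant_pseudometric_equicontinuous_quotient\<close>). It is enough to check
  \<open>\<rho> (f x) (f y) \<le> \<rho> x y\<close>, because a nonexpansive surjection of a compact space is an isometry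
  (\<open>nonexpansive_surj_imp_invariant\<close>).

  The intersection of the zero sets of all invariant pseudometrics is already the intersection of
  countably many of them, since its complement in \<open>X \<times> X\<close> is \<open>\<sigma>\<close>-compact, and hence it is the zero
  set of a single invariant pseudometric \<open>\<rho>\<close>. This zero set is \<open>S_eq\<close> (\<open>S_eq_eq_zero_set\<close>). The
  factors of \<open>(X, f)\<close> being described by pseudometrics, the quotient by \<open>S_eq\<close> is the maximal
  equicontinuous factor.

  For connectedness, let \<open>\<sigma> x y\<close> be the infimum of the \<open>\<rho>\<close>-diameters of the connected subsets of \<open>X\<close>
  that contain \<open>x\<close> and \<open>y\<close>. This is a pseudometric; it is continuous because \<open>X\<close> is locally connected,
  and \<open>f\<close> is nonexpansive for it because images of connected sets are connected. So \<open>\<sigma>\<close> is invariant,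
  and by minimality of \<open>S_eq\<close> it vanishes on \<open>S_eq\<close>. Two points of one class of \<open>S_eq\<close> thus lie
  together in connected sets of arbitrarily small \<open>\<rho>\<close>-diameter. If the class split into two disjoint
  nonempty closed sets, then such a set, if small enough, would lie in the union of two disjoint open
  neighbourhoods of the parts and, for points in different parts, meet both, which is
  impossible (\<open>connected_zero_set_class\<close>).
\<close>

section \<open>Continuous pseudometrics on a subset of a metric space\<close>

text \<open>
  Values outside the carrier \<open>X\<close> are irrelevant. Nonnegativity follows from the three axioms.
\<close>

definition pseudometric_on :: "'a set \<Rightarrow> ('a \<Rightarrow> 'a \<Rightarrow> real) \<Rightarrow> bool" where
  "pseudometric_on X \<rho> \<longleftrightarrow>
     (\<forall>x\<in>X. \<rho> x x = 0) \<and> (\<forall>x\<in>X. \<forall>y\<in>X. \<rho> x y = \<rho> y x) \<and>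
     (\<forall>x\<in>X. \<forall>y\<in>X. \<forall>z\<in>X. \<rho> x z \<le> \<rho> x y + \<rho> y z)"

lemma pseudometric_on_refl: "pseudometric_on X \<rho> \<Longrightarrow> x \<in> X \<Longrightarrow> \<rho> x x = 0"
  and pseudometric_on_sym: "pseudometric_on X \<rho> \<Longrightarrow> x \<in> X \<Longrightarrow> y \<in> X \<Longrightarrow> \<rho> x y = \<rho> y x"
  and pseudometric_on_triangle:
    "pseudometric_on X \<rho> \<Longrightarrow> x \<in> X \<Longrightarrow> y \<in> X \<Longrightarrow> z \<in> X \<Longrightarrow> \<rho> x z \<le> \<rho> x y + \<rho> y z"
  unfolding pseudometric_on_def by blast+

lemma pseudometric_on_nonneg:
  assumes "pseudometric_on X \<rho>" "x \<in> X" "y \<in> X"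
  shows "0 \<le> \<rho> x y"
  using pseudometric_on_triangle[OF assms assms(2)] pseudometric_on_sym[OF assms]
    pseudometric_on_refl[OF assms(1,2)] by linarith

lemma pseudometric_on_min:
  assumes "pseudometric_on X \<rho>" "0 \<le> c"
  shows "pseudometric_on X (\<lambda>x y. min c (\<rho> x y))"
  unfolding pseudometric_on_def
proof (intro conjI ballI)
  fix x y z assume xyz: "x \<in> X" "y \<in> X" "z \<in> X"
  then show "min c (\<rho> x z) \<le> min c (\<rho> x y) + min c (\<rho> y z)"
    using pseudometric_on_triangle[OF assms(1) xyz] assms
      pseudometric_on_nonneg[OF assms(1) xyz(1,2)] pseudometric_on_nonneg[OF assms(1) xyz(2,3)]
    by (auto simp: min_def)
qed (use assms in \<open>auto simp: pseudometric_on_refl intro: pseudometric_on_sym arg_cong2[where f=min]\<close>)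

lemma pseudometric_on_SUP:
  fixes \<rho> :: "nat \<Rightarrow> 'a \<Rightarrow> 'a \<Rightarrow> real"
  assumes \<rho>: "\<And>n. pseudometric_on X (\<rho> n)"
    and le: "\<And>n x y. x \<in> X \<Longrightarrow> y \<in> X \<Longrightarrow> \<rho> n x y \<le> B"
  shows "pseudometric_on X (\<lambda>x y. SUP n. \<rho> n x y)"
  unfolding pseudometric_on_def
proof (intro conjI ballI)
  fix x assume "x \<in> X"
  then show "(SUP n. \<rho> n x x) = 0"
    using pseudometric_on_refl[OF \<rho>] by simp
next
  fix x y assume "x \<in> X" "y \<in> X"
  then show "(SUP n. \<rho> n x y) = (SUP n. \<rho> n y x)"
    using pseudometric_on_sym[OF \<rho>] by simp
next
  fix x y z assume xyz: "x \<in> X" "y \<in> X" "z \<in> X"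
  have upper: "\<rho> n u v \<le> (SUP n. \<rho> n u v)" if "u \<in> X" "v \<in> X" for n u v
    by (rule cSUP_upper) (use le that in \<open>auto intro!: bdd_aboveI2[where M=B]\<close>)
  show "(SUP n. \<rho> n x z) \<le> (SUP n. \<rho> n x y) + (SUP n. \<rho> n y z)"
  proof (rule cSUP_least)
    fix n
    show "\<rho> n x z \<le> (SUP n. \<rho> n x y) + (SUP n. \<rho> n y z)"
      using pseudometric_on_triangle[OF \<rho> xyz, of n] upper[OF xyz(1,2), of n]
        upper[OF xyz(2,3), of n] by linarith
  qed simp
qed

text \<open>
  Continuity is only demanded at the diagonal, which by the triangle inequality gives joint
  continuity (\<open>continuous_pseudometric_continuous_on\<close>). The punctured filter suffices because
  \<open>\<rho> x x = 0\<close>.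
\<close>

definition continuous_pseudometric ::
    "'a::metric_space set \<Rightarrow> ('a \<Rightarrow> 'a \<Rightarrow> real) \<Rightarrow> bool" where
  "continuous_pseudometric X \<rho> \<longleftrightarrow>
     pseudometric_on X \<rho> \<and> (\<forall>x\<in>X. \<forall>e>0. \<forall>\<^sub>F y in at x within X. \<rho> x y < e)"

lemma continuous_pseudometricD:
  assumes "continuous_pseudometric X \<rho>" "x \<in> X" "e > 0"
  obtains \<delta> where "\<delta> > 0" "\<And>y. y \<in> X \<Longrightarrow> dist y x < \<delta> \<Longrightarrow> \<rho> x y < e"
proof -
  from assms have "\<forall>\<^sub>F y in at x within X. \<rho> x y < e"
    by (auto simp: continuous_pseudometric_def)
  then obtain \<delta> where "\<delta> > 0" "\<And>y. y \<in> X \<Longrightarrow> y \<noteq> x \<Longrightarrow> dist y x < \<delta> \<Longrightarrow> \<rho> x y < e"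
    by (auto simp: eventually_at)
  moreover have "\<rho> x x < e"
    using assms pseudometric_on_refl[of X \<rho> x] by (simp add: continuous_pseudometric_def)
  ultimately show thesis
    by (metis that)
qed

lemma continuous_pseudometricI:
  assumes "pseudometric_on X \<rho>"
    and "\<And>x e. x \<in> X \<Longrightarrow> e > 0 \<Longrightarrow>
      \<exists>U. openin (top_of_set X) U \<and> x \<in> U \<and> (\<forall>y\<in>U. \<rho> x y < e)"
  shows "continuous_pseudometric X \<rho>"
  unfolding continuous_pseudometric_def
proof (intro conjI ballI allI impI)
  fix x and e :: real assume "x \<in> X" "0 < e"
  then obtain U where U: "openin (top_of_set X) U" "x \<in> U" "\<forall>y\<in>U. \<rho> x y < e"
    using assms(2) by blast
  then obtain W where "open W" "U = X \<inter> W"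
    by (auto simp: openin_open)
  with U show "\<forall>\<^sub>F y in at x within X. \<rho> x y < e"
    unfolding eventually_at_topological by blast
qed (fact assms(1))

lemma continuous_pseudometric_continuous_on:
  assumes "continuous_pseudometric X \<rho>"
  shows "continuous_on (X \<times> X) (\<lambda>(x, y). \<rho> x y)"
  unfolding continuous_on_iff
proof clarify
  fix a b and e :: real assume ab: "a \<in> X" "b \<in> X" and "0 < e"
  have \<rho>: "pseudometric_on X \<rho>"
    using assms by (simp add: continuous_pseudometric_def)
  obtain \<delta>1 where d1: "\<delta>1 > 0" "\<And>y. y \<in> X \<Longrightarrow> dist y a < \<delta>1 \<Longrightarrow> \<rho> a y < e / 2"
    using continuous_pseudometricD[OF assms ab(1), of "e / 2"] \<open>0 < e\<close> by auto
  obtain \<delta>2 where d2: "\<delta>2 > 0" "\<And>y. y \<in> X \<Longrightarrow> dist y b < \<delta>2 \<Longrightarrow> \<rho> b y < e / 2"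
    using continuous_pseudometricD[OF assms ab(2), of "e / 2"] \<open>0 < e\<close> by auto
  show "\<exists>\<delta>>0. \<forall>p\<in>X \<times> X. dist p (a, b) < \<delta> \<longrightarrow>
      dist (case p of (x, y) \<Rightarrow> \<rho> x y) (\<rho> a b) < e"
  proof (intro exI[of _ "min \<delta>1 \<delta>2"] conjI ballI impI)
    fix p assume p: "p \<in> X \<times> X" "dist p (a, b) < min \<delta>1 \<delta>2"
    obtain x y where xy: "p = (x, y)" "x \<in> X" "y \<in> X"
      using p(1) by blast
    have "dist x a < \<delta>1" "dist y b < \<delta>2"
      using p(2) dist_fst_le[of p "(a, b)"] dist_snd_le[of p "(a, b)"] xy(1) by auto
    then have "\<rho> a x < e / 2" "\<rho> b y < e / 2"
      using d1 d2 xy by auto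
    moreover have "\<rho> x y \<le> \<rho> x a + (\<rho> a b + \<rho> b y)" "\<rho> a b \<le> \<rho> a x + (\<rho> x y + \<rho> y b)"
      using pseudometric_on_triangle[OF \<rho> xy(2) ab(1) xy(3)]
        pseudometric_on_triangle[OF \<rho> ab(1) ab(2) xy(3)]
        pseudometric_on_triangle[OF \<rho> ab(1) xy(2) ab(2)]
        pseudometric_on_triangle[OF \<rho> xy(2) xy(3) ab(2)] by linarith+
    moreover have "\<rho> x a = \<rho> a x" "\<rho> y b = \<rho> b y"
      using pseudometric_on_sym[OF \<rho>] xy ab by auto
    ultimately show "dist (case p of (x, y) \<Rightarrow> \<rho> x y) (\<rho> a b) < e"
      by (simp add: xy(1) dist_real_def)
  qed (use d1 d2 in auto)
qed

section \<open>Invariant pseudometrics\<close>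

text \<open>
  A continuous pseudometric on \<open>X\<close> for which \<open>f\<close> is distance preserving.
\<close>

definition invariant_pseudometric ::
    "'a::metric_space set \<Rightarrow> ('a \<Rightarrow> 'a) \<Rightarrow> ('a \<Rightarrow> 'a \<Rightarrow> real) \<Rightarrow> bool" where
  "invariant_pseudometric X f \<rho> \<longleftrightarrow>
     continuous_pseudometric X \<rho> \<and> (\<forall>x\<in>X. \<forall>y\<in>X. \<rho> (f x) (f y) = \<rho> x y)"

text \<open>
  The kernel of a pseudometric: the equivalence relation of being at distance zero in \<open>X\<close>.
\<close>

definition zero_set :: "'a set \<Rightarrow> ('a \<Rightarrow> 'a \<Rightarrow> real) \<Rightarrow> ('a \<times> 'a) set" where
  "zero_set X \<rho> = {(x, y). x \<in> X \<and> y \<in> X \<and> \<rho> x y = 0}"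

text \<open>
  Continue the pair \<open>(x, y)\<close> to a backward orbit under \<open>f \<times> f\<close>, along which \<open>\<rho>\<close> cannot decrease. By
  compactness two members of the orbit are nearly equal; pushing both forward shows that
  \<open>(f x, f y)\<close> is close to some member of the orbit, whence \<open>\<rho> x y \<le> \<rho> (f x) (f y)\<close> up to
  an arbitrarily small error.
\<close>

lemma nonexpansive_surj_imp_invariant:
  fixes X :: "'a::metric_space set"
  assumes "compact X" and surj: "f ` X = X" and cp: "continuous_pseudometric X \<rho>"
    and nonexp: "\<And>x y. x \<in> X \<Longrightarrow> y \<in> X \<Longrightarrow> \<rho> (f x) (f y) \<le> \<rho> x y"
  shows "invariant_pseudometric X f \<rho>"
proof -
  have \<rho>: "pseudometric_on X \<rho>"
    using cp by (simp add: continuous_pseudometric_def)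
  have iter_in: "(f ^^ n) x \<in> X" if "x \<in> X" for n x
    using that surj by (induction n) auto
  have iter_le: "\<rho> ((f ^^ n) x) ((f ^^ n) y) \<le> \<rho> x y" if "x \<in> X" "y \<in> X" for n x y
  proof (induction n)
    case (Suc n)
    show ?case
      using nonexp[OF iter_in[OF that(1), of n] iter_in[OF that(2), of n]] Suc by simp
  qed simp
  define g where "g = inv_into X f"
  have g_in: "(g ^^ n) x \<in> X" if "x \<in> X" for n x
    using that surj by (induction n) (auto simp: g_def inv_into_into)
  have fg: "(f ^^ k) ((g ^^ (k + j)) x) = (g ^^ j) x" if "x \<in> X" for k j x
  proof (induction k)
    case (Suc k)
    have "f ((g ^^ (Suc k + j)) x) = (g ^^ (k + j)) x"
      using f_inv_into_f[of "(g ^^ (k + j)) x" f X] g_in[OF that] surj by (simp add: g_def)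
    then show ?case
      using Suc by (simp add: funpow_swap1)
  qed simp
  have "\<rho> x y \<le> \<rho> (f x) (f y)" if x: "x \<in> X" and y: "y \<in> X" for x y
  proof (rule field_le_epsilon)
    fix e :: real assume "0 < e"
    have "seq_compact (X \<times> X)"
      using assms(1) by (simp add: compact_Times flip: compact_eq_seq_compact_metric)
    moreover have "\<forall>n. ((g ^^ n) x, (g ^^ n) y) \<in> X \<times> X"
      using g_in x y by auto
    ultimately obtain l r where l: "l \<in> X \<times> X" and r: "strict_mono (r :: nat \<Rightarrow> nat)"
      and lim: "((\<lambda>n. ((g ^^ n) x, (g ^^ n) y)) \<circ> r) \<longlonglongrightarrow> l"
      by (rule seq_compactE)
    obtain a b where ab: "l = (a, b)" "a \<in> X" "b \<in> X"
      using l by auto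
    have "(\<lambda>n. (g ^^ r n) x) \<longlonglongrightarrow> a" "(\<lambda>n. (g ^^ r n) y) \<longlonglongrightarrow> b"
      using tendsto_fst[OF lim] tendsto_snd[OF lim] ab by (simp_all add: o_def)
    moreover obtain \<delta>1 where d1: "\<delta>1 > 0" "\<And>z. z \<in> X \<Longrightarrow> dist z a < \<delta>1 \<Longrightarrow> \<rho> a z < e / 4"
      using continuous_pseudometricD[OF cp ab(2), of "e / 4"] \<open>0 < e\<close> by auto
    moreover obtain \<delta>2 where d2: "\<delta>2 > 0" "\<And>z. z \<in> X \<Longrightarrow> dist z b < \<delta>2 \<Longrightarrow> \<rho> b z < e / 4"
      using continuous_pseudometricD[OF cp ab(3), of "e / 4"] \<open>0 < e\<close> by auto
    ultimately have "\<forall>\<^sub>F n in sequentially. dist ((g ^^ r n) x) a < \<delta>1 \<and> dist ((g ^^ r n) y) b < \<delta>2"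
      by (intro eventually_conj tendstoD)
    then obtain m where
      m: "\<And>n. n \<ge> m \<Longrightarrow> dist ((g ^^ r n) x) a < \<delta>1 \<and> dist ((g ^^ r n) y) b < \<delta>2"
      by (auto simp: eventually_sequentially)
    \<comment> \<open>The positions \<open>r m\<close> and \<open>r (Suc m)\<close> of the backward orbit are close to each other; after
        \<open>Suc (r m)\<close> steps of \<open>f\<close> they have become the positions \<open>-1\<close> and \<open>j\<close>.\<close>
    define k where "k = r m"
    have "k < r (Suc m)"
      using r by (simp add: k_def strict_mono_def)
    then obtain j where j: "r (Suc m) = Suc k + j"
      by (metis less_iff_Suc_add add_Suc)
    have close: "\<rho> ((g ^^ k) z) ((g ^^ (Suc k + j)) z) < e / 2"
      if z: "z \<in> X" and c: "c \<in> X" and zc: "\<rho> c ((g ^^ k) z) < e / 4"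
        "\<rho> c ((g ^^ (Suc k + j)) z) < e / 4" for z c
      using pseudometric_on_triangle[OF \<rho> g_in[OF z] c g_in[OF z], of k "Suc k + j"]
        pseudometric_on_sym[OF \<rho> g_in[OF z] c, of k] zc by linarith
    have return: "\<rho> (f z) ((g ^^ j) z) < e / 2"
      if z: "z \<in> X" and "\<rho> ((g ^^ k) z) ((g ^^ (Suc k + j)) z) < e / 2" for z
    proof -
      have "(f ^^ Suc k) ((g ^^ k) z) = f z"
        using fg[OF z, of k 0] by simp
      moreover have "(f ^^ Suc k) ((g ^^ (Suc k + j)) z) = (g ^^ j) z"
        by (rule fg[OF z])
      ultimately show ?thesis
        using iter_le[OF g_in[OF z] g_in[OF z], of "Suc k" k "Suc k + j"] that(2) by simp
    qed
    have near: "dist ((g ^^ k) x) a < \<delta>1" "dist ((g ^^ k) y) b < \<delta>2"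
      "dist ((g ^^ (Suc k + j)) x) a < \<delta>1" "dist ((g ^^ (Suc k + j)) y) b < \<delta>2"
      using m[of m] m[of "Suc m", unfolded j] by (simp_all add: k_def del: funpow.simps)
    have "\<rho> (f x) ((g ^^ j) x) < e / 2"
      by (intro return[OF x] close[OF x ab(2)] d1(2) g_in[OF x] near)
    moreover have "\<rho> (f y) ((g ^^ j) y) < e / 2"
      by (intro return[OF y] close[OF y ab(3)] d2(2) g_in[OF y] near)
    moreover have "\<rho> x y \<le> \<rho> ((g ^^ j) x) ((g ^^ j) y)"
      using iter_le[OF g_in[OF x] g_in[OF y], of j j j] fg[OF x, of j 0] fg[OF y, of j 0] by simp
    moreover have fx: "f x \<in> X" "f y \<in> X"
      using x y surj by auto
    moreover have "\<rho> ((g ^^ j) x) ((g ^^ j) y) \<le> \<rho> ((g ^^ j) x) (f x) + (\<rho> (f x) (f y) + \<rho> (f y) ((g ^^ j) y))"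
      using pseudometric_on_triangle[OF \<rho> g_in[OF x] fx(1) g_in[OF y], of j j]
        pseudometric_on_triangle[OF \<rho> fx g_in[OF y], of j] by linarith
    ultimately show "\<rho> x y \<le> \<rho> (f x) (f y) + e"
      using pseudometric_on_sym[OF \<rho> g_in[OF x] fx(1), of j] by linarith
  qed
  with nonexp cp show ?thesis
    by (auto simp: invariant_pseudometric_def intro: antisym)
qed

section \<open>From equicontinuous factors to invariant pseudometrics and back\<close>

lemma factor_map_quotient:
  assumes R: "closed_invariant_equiv T f R"
  shows "factor_map T f (quotient_topology T R) (induced_map R f) (\<lambda>x. R `` {x})"
  using quotient_map_quotient_topology[of T R] induced_map_class[OF R]
  by (auto simp: factor_map_def quotient_imp_continuous_map quotient_imp_surjective_map)

text \<open>
  The supremum over the forward iterates is plainly nonexpansive, and therefore invariant. The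
  truncation at 1 makes the supremum finite without an appeal to compactness of \<open>V\<close>.
\<close>

lemma equicontinuous_factor_imp_invariant_pseudometric:
  fixes X :: "'a::metric_space set" and V :: "'b topology"
  assumes X: "compact X" "f ` X = X"
    and fac: "factor_map (top_of_set X) f V h \<pi>" and eq: "equicontinuous_system V h"
  shows "\<exists>\<rho>. invariant_pseudometric X f \<rho> \<and>
    zero_set X \<rho> = {(x, y). x \<in> X \<and> y \<in> X \<and> \<pi> x = \<pi> y}"
proof -
  obtain d where M: "Metric_space (topspace V) d"
    and top: "Metric_space.mtopology (topspace V) d = V"
    and equi: "\<And>p e. p \<in> topspace V \<Longrightarrow> e > 0 \<Longrightarrow> \<exists>\<delta>>0. \<forall>q\<in>topspace V. d p q < \<delta> \<longrightarrow>
      (\<forall>n. d (int_iterate (topspace V) h n p) (int_iterate (topspace V) h n q) < e)"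
    using eq unfolding equicontinuous_system_def by blast
  interpret M: Metric_space "topspace V" d
    by (fact M)
  have cont: "continuous_map (top_of_set X) V \<pi>" and \<pi>f: "\<And>x. x \<in> X \<Longrightarrow> \<pi> (f x) = h (\<pi> x)"
    and \<pi>_in: "\<And>x. x \<in> X \<Longrightarrow> \<pi> x \<in> topspace V"
    using fac by (auto simp: factor_map_def)
  have "h \<in> topspace V \<rightarrow> topspace V"
    using eq by (auto simp: equicontinuous_system_def dynamical_system_def continuous_map_def)
  then have h_in: "(h ^^ n) p \<in> topspace V" if "p \<in> topspace V" for n p
    using that by (induction n) auto
  define r where "r n x y = min 1 (d ((h ^^ n) (\<pi> x)) ((h ^^ n) (\<pi> y)))" for n x y
  define \<rho> where "\<rho> x y = (SUP n. r n x y)" for x y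
  have r: "pseudometric_on X (r n)" for n
    unfolding r_def
    by (rule pseudometric_on_min)
      (auto simp: pseudometric_on_def M.commute h_in \<pi>_in intro!: M.triangle)
  have bdd: "bdd_above (range (\<lambda>n. r n x y))" for x y
    by (auto intro!: bdd_aboveI2[where M=1] simp: r_def)
  have r_le: "r n x y \<le> \<rho> x y" for n x y
    unfolding \<rho>_def by (rule cSUP_upper) (auto intro: bdd)
  have \<rho>: "pseudometric_on X \<rho>"
    unfolding \<rho>_def by (rule pseudometric_on_SUP[where B=1, OF r]) (simp add: r_def)
  have cp: "continuous_pseudometric X \<rho>"
  proof (rule continuous_pseudometricI[OF \<rho>])
    fix x and e :: real assume x: "x \<in> X" and "0 < e"
    then obtain \<delta> where "\<delta> > 0" and \<delta>: "\<And>q n. q \<in> topspace V \<Longrightarrow> d (\<pi> x) q < \<delta> \<Longrightarrow>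
      d (int_iterate (topspace V) h n (\<pi> x)) (int_iterate (topspace V) h n q) < e / 2"
      using equi[of "\<pi> x" "e / 2"] \<pi>_in by auto
    define U where "U = {y \<in> X. \<pi> y \<in> M.mball (\<pi> x) \<delta>}"
    have "openin V (M.mball (\<pi> x) \<delta>)"
      using M.openin_mball[of "\<pi> x" \<delta>] by (simp add: top)
    then have "openin (top_of_set X) U"
      using openin_continuous_map_preimage[OF cont] unfolding U_def by force
    moreover have "x \<in> U"
      using x \<pi>_in \<open>\<delta> > 0\<close> by (simp add: U_def)
    moreover have "\<rho> x y < e" if y: "y \<in> U" for y
    proof -
      have "r n x y \<le> e / 2" for n
        using \<delta>[of "\<pi> y" "int n"] y by (auto simp: r_def U_def int_iterate_def)
      then have "\<rho> x y \<le> e / 2"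
        unfolding \<rho>_def by (intro cSUP_least) auto
      then show ?thesis
        using \<open>0 < e\<close> by simp
    qed
    ultimately show "\<exists>U. openin (top_of_set X) U \<and> x \<in> U \<and> (\<forall>y\<in>U. \<rho> x y < e)"
      by blast
  qed
  have "\<rho> (f x) (f y) \<le> \<rho> x y" if "x \<in> X" "y \<in> X" for x y
  proof -
    have "r n (f x) (f y) = r (Suc n) x y" for n
      using that by (simp add: r_def \<pi>f funpow_swap1)
    then have "\<rho> (f x) (f y) = (SUP n. r (Suc n) x y)"
      by (simp add: \<rho>_def)
    also have "\<dots> \<le> \<rho> x y"
      by (rule cSUP_least) (auto intro: r_le)
    finally show ?thesis .
  qed
  then have "invariant_pseudometric X f \<rho>"
    using nonexpansive_surj_imp_invariant[OF X cp] by blast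
  moreover have "\<rho> x y = 0 \<longleftrightarrow> \<pi> x = \<pi> y" if "x \<in> X" "y \<in> X" for x y
  proof
    assume "\<rho> x y = 0"
    then have "d (\<pi> x) (\<pi> y) \<le> 0"
      using r_le[of 0 x y] by (simp add: r_def min_def split: if_splits)
    then show "\<pi> x = \<pi> y"
      using M.nonneg[of "\<pi> x" "\<pi> y"] M.zero[of "\<pi> x" "\<pi> y"] \<pi>_in that by auto
  next
    assume "\<pi> x = \<pi> y"
    then have "r n x y = 0" for n
      using that by (simp add: r_def h_in \<pi>_in)
    then show "\<rho> x y = 0"
      by (simp add: \<rho>_def)
  qed
  ultimately show ?thesis
    by (auto simp: zero_set_def)
qed

lemma int_iterate_isometry:
  assumes bij: "bij_betw g S S"
    and iso: "\<And>p q. p \<in> S \<Longrightarrow> q \<in> S \<Longrightarrow> d (g p) (g q) = d p q"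
    and "p \<in> S" "q \<in> S"
  shows "d (int_iterate S g n p) (int_iterate S g n q) = d p q"
proof -
  have iter: "d ((k ^^ m) p) ((k ^^ m) q) = d p q"
    if "k ` S = S" and "\<And>p q. p \<in> S \<Longrightarrow> q \<in> S \<Longrightarrow> d (k p) (k q) = d p q" for k m
  proof -
    have "(k ^^ m) z \<in> S" if "z \<in> S" for z m
      using \<open>k ` S = S\<close> that by (induction m) auto
    then show ?thesis
      using that assms(3,4) by (induction m) auto
  qed
  have "g ` S = S"
    using bij by (simp add: bij_betw_def)
  moreover have "inv_into S g ` S = S"
    using bij_betw_inv_into[OF bij] by (simp add: bij_betw_def)
  moreover have "d (inv_into S g u) (inv_into S g v) = d u v" if "u \<in> S" "v \<in> S" for u v
    using iso[of "inv_into S g u" "inv_into S g v"] that \<open>g ` S = S\<close>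
    by (simp add: inv_into_into f_inv_into_f)
  ultimately show ?thesis
    using iter[of g] iter[of "inv_into S g"] iso by (simp add: int_iterate_def)
qed

lemma equiv_zero_set:
  assumes \<rho>: "pseudometric_on X \<rho>"
  shows "equiv X (zero_set X \<rho>)"
proof (rule equivI)
  show "refl_on X (zero_set X \<rho>)"
    using pseudometric_on_refl[OF \<rho>] by (auto simp: refl_on_def zero_set_def)
  show "sym (zero_set X \<rho>)"
    using pseudometric_on_sym[OF \<rho>] by (auto simp: sym_def zero_set_def)
  show "trans (zero_set X \<rho>)"
  proof (rule transI)
    fix x y z assume "(x, y) \<in> zero_set X \<rho>" "(y, z) \<in> zero_set X \<rho>"
    then have "x \<in> X" "y \<in> X" "z \<in> X" "\<rho> x y = 0" "\<rho> y z = 0"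
      by (auto simp: zero_set_def)
    then show "(x, z) \<in> zero_set X \<rho>"
      using pseudometric_on_triangle[OF \<rho>, of x y z] pseudometric_on_nonneg[OF \<rho>, of x z]
      by (simp add: zero_set_def)
  qed
qed (auto simp: zero_set_def)

text \<open>
  The pseudometric descends to a metric on the set of classes. By compactness of \<open>X\<close>, the metric
  topology is the quotient topology, and the induced map is a bijective isometry.
\<close>

lemma invariant_pseudometric_equicontinuous_quotient:
  fixes X :: "'a::metric_space set"
  assumes X: "compact X" "continuous_on X f" "f ` X = X"
    and inv: "invariant_pseudometric X f \<rho>"
  defines "R \<equiv> zero_set X \<rho>"
  shows "closed_invariant_equiv (top_of_set X) f R"
    and "equicontinuous_system (quotient_topology (top_of_set X) R) (induced_map R f)"
proof -
  have cp: "continuous_pseudometric X \<rho>" and iso: "\<And>x y. x \<in> X \<Longrightarrow> y \<in> X \<Longrightarrow> \<rho> (f x) (f y) = \<rho> x y"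
    using inv by (auto simp: invariant_pseudometric_def)
  then have \<rho>: "pseudometric_on X \<rho>"
    by (simp add: continuous_pseudometric_def)
  have f_in: "f x \<in> X" if "x \<in> X" for x
    using X(3) that by blast
  have R: "equiv X R"
    unfolding R_def by (rule equiv_zero_set[OF \<rho>])
  have "closedin (top_of_set (X \<times> X)) (X \<times> X \<inter> (\<lambda>(x, y). \<rho> x y) -` {0})"
    by (intro continuous_closedin_preimage continuous_pseudometric_continuous_on cp) simp
  moreover have "X \<times> X \<inter> (\<lambda>(x, y). \<rho> x y) -` {0} = R"
    by (auto simp: R_def zero_set_def)
  ultimately have "closedin (prod_topology (top_of_set X) (top_of_set X)) R"
    by (simp add: prod_topology_subtopology_eu)
  then show ci: "closed_invariant_equiv (top_of_set X) f R"
    using R f_in iso by (auto simp: closed_invariant_equiv_def R_def zero_set_def)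
  have mem: "(x, y) \<in> R \<longleftrightarrow> x \<in> X \<and> y \<in> X \<and> \<rho> x y = 0" for x y
    by (simp add: R_def zero_set_def)
  let ?q = "\<lambda>x. R `` {x}"
  let ?Q = "quotient_topology (top_of_set X) R"
  let ?g = "induced_map R f"
  have Q: "topspace ?Q = X // R"
    by (simp add: topspace_quotient_topology)
  have Qim: "X // R = ?q ` X"
    by (auto simp: quotient_def)
  have g: "?g (?q x) = ?q (f x)" if "x \<in> X" for x
    using induced_map_class[OF ci] that by simp
  \<comment> \<open>The value 0 away from the set of classes is needed because the metric space axioms ask for
      nonnegativity and symmetry on the whole type.\<close>
  define d where "d P P' =
    (if P \<in> X // R \<and> P' \<in> X // R then \<rho> (SOME x. x \<in> P) (SOME y. y \<in> P') else 0)" for P P'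
  have d: "d (?q x) (?q y) = \<rho> x y" if x: "x \<in> X" and y: "y \<in> X" for x y
  proof -
    have rep: "(SOME z. z \<in> ?q x) \<in> X \<and> \<rho> x (SOME z. z \<in> ?q x) = 0" if "x \<in> X" for x
    proof -
      have "x \<in> ?q x"
        using equiv_class_self[OF R that] .
      then have "(SOME z. z \<in> ?q x) \<in> ?q x"
        by (rule someI)
      then show ?thesis
        unfolding Image_singleton_iff using mem by blast
    qed
    define a b where "a = (SOME z. z \<in> ?q x)" and "b = (SOME z. z \<in> ?q y)"
    have a: "a \<in> X" "\<rho> x a = 0" and b: "b \<in> X" "\<rho> y b = 0"
      using rep x y by (auto simp: a_def b_def)
    have "\<rho> a b = \<rho> x y"
      using pseudometric_on_triangle[OF \<rho> a(1) x b(1)] pseudometric_on_triangle[OF \<rho> x y b(1)]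
        pseudometric_on_triangle[OF \<rho> x a(1) y] pseudometric_on_triangle[OF \<rho> a(1) b(1) y]
        pseudometric_on_sym[OF \<rho> x a(1)] pseudometric_on_sym[OF \<rho> y b(1)] a b by linarith
    then show ?thesis
      using x y by (simp add: d_def a_def b_def quotientI)
  qed
  have q_eq: "?q x = ?q y \<longleftrightarrow> \<rho> x y = 0" if "x \<in> X" "y \<in> X" for x y
    using eq_equiv_class_iff[OF R that] that by (simp add: mem)
  interpret M: Metric_space "X // R" d
  proof
    show "0 \<le> d P P'" for P P'
    proof (cases "P \<in> X // R \<and> P' \<in> X // R")
      case True
      then show ?thesis
        using pseudometric_on_nonneg[OF \<rho>] by (auto simp: Qim d)
    qed (auto simp: d_def)
    show "d P P' = d P' P" for P P'
    proof (cases "P \<in> X // R \<and> P' \<in> X // R")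
      case True
      then show ?thesis
        using pseudometric_on_sym[OF \<rho>] by (auto simp: Qim d)
    qed (auto simp: d_def)
    show "d P P' = 0 \<longleftrightarrow> P = P'" if "P \<in> X // R" "P' \<in> X // R" for P P'
    proof -
      from that obtain x y where xy: "x \<in> X" "y \<in> X" "P = ?q x" "P' = ?q y"
        by (auto simp: Qim)
      show ?thesis
        unfolding xy(3,4) d[OF xy(1,2)] q_eq[OF xy(1,2)] ..
    qed
    show "d P P'' \<le> d P P' + d P' P''"
      if "P \<in> X // R" "P' \<in> X // R" "P'' \<in> X // R" for P P' P''
      using that pseudometric_on_triangle[OF \<rho>] by (auto simp: Qim d)
  qed
  have "continuous_map (top_of_set X) M.mtopology ?q"
    unfolding M.continuous_map_to_metric
  proof (intro ballI allI impI)
    fix x and e :: real assume x: "x \<in> topspace (top_of_set X)" and "0 < e"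
    then obtain \<delta> where "\<delta> > 0" and \<delta>: "\<And>y. y \<in> X \<Longrightarrow> dist y x < \<delta> \<Longrightarrow> \<rho> x y < e"
      using continuous_pseudometricD[OF cp, of x e] by auto
    have "?q y \<in> M.mball (?q x) e" if "y \<in> X \<inter> ball x \<delta>" for y
      using that x \<delta>[of y] d[of x y] by (simp add: quotientI dist_commute)
    then show "\<exists>U. openin (top_of_set X) U \<and> x \<in> U \<and> (\<forall>y\<in>U. ?q y \<in> M.mball (?q x) e)"
      using x \<open>\<delta> > 0\<close> by (intro exI[of _ "X \<inter> ball x \<delta>"]) (auto intro: openin_open_Int)
  qed
  then have "quotient_map (top_of_set X) M.mtopology ?q"
    using X(1) by (intro T1_Spaces.continuous_imp_quotient_map M.Hausdorff_space_mtopology)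
      (simp_all add: compact_space_subtopology flip: Qim)
  then have openin_M: "openin M.mtopology V \<longleftrightarrow> openin (top_of_set X) {x \<in> X. ?q x \<in> V}"
    if "V \<subseteq> X // R" for V
    using that by (simp add: quotient_map_def)
  have top: "M.mtopology = ?Q"
    unfolding topology_eq
  proof
    fix V
    show "openin M.mtopology V \<longleftrightarrow> openin ?Q V"
    proof (cases "V \<subseteq> X // R")
      case True
      then show ?thesis
        by (simp add: openin_M openin_quotient_topology)
    next
      case False
      then show ?thesis
        using openin_subset[of M.mtopology V] by (auto simp: openin_quotient_topology)
    qed
  qed
  have "compact_space ?Q"
    using image_compactin[of "top_of_set X" X ?Q ?q] X(1)
      quotient_imp_continuous_map[OF quotient_map_quotient_topology, of "top_of_set X" R]
    by (simp add: compact_space_def Q compactin_subtopology flip: Qim)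
  moreover have "metrizable_space ?Q"
    using M.metrizable_space_mtopology by (simp add: top)
  moreover have cont: "continuous_map ?Q ?Q ?g"
  proof -
    have "continuous_map (top_of_set X) ?Q (?q \<circ> f)"
    proof (rule continuous_map_compose)
      show "continuous_map (top_of_set X) (top_of_set X) f"
        using X by auto
    qed (rule quotient_imp_continuous_map[OF quotient_map_quotient_topology])
    then have "continuous_map (top_of_set X) ?Q (?g \<circ> ?q)"
      by (rule continuous_map_eq) (simp add: g)
    then show ?thesis
      using continuous_compose_quotient_map[OF quotient_map_quotient_topology] by blast
  qed
  ultimately have ds: "dynamical_system ?Q ?g"
    by (simp add: dynamical_system_def)
  have surj: "?g ` (X // R) = X // R"
    using X(3) by (auto simp: Qim g f_in image_iff) (metis X(3) g imageE)
  have inj: "inj_on ?g (X // R)"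
    by (auto simp: inj_on_def Qim g q_eq f_in iso)
  have "homeomorphic_map ?Q ?Q ?g"
    using cont surj inj ds by (intro continuous_imp_homeomorphic_map)
      (auto simp: Q dynamical_system_def metrizable_imp_Hausdorff_space)
  moreover have "d (int_iterate (X // R) ?g n P) (int_iterate (X // R) ?g n P') = d P P'"
    if "P \<in> X // R" "P' \<in> X // R" for n P P'
    by (rule int_iterate_isometry) (use surj inj that in \<open>auto simp: bij_betw_def Qim g d f_in iso\<close>)
  \<comment> \<open>All integer iterates being isometries, \<open>\<delta> = e\<close> works.\<close>
  ultimately show "equicontinuous_system ?Q ?g"
    unfolding equicontinuous_system_def Q using ds top M.Metric_space_axioms
    by (intro conjI exI[of _ d]) auto
qed

section \<open>The relation \<open>S_eq\<close> as the zero set of one invariant pseudometric\<close>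

text \<open>
  The difference is the union of the compact sets of points of \<open>K\<close> at distance at least
  \<open>1 / (n + 1)\<close> from \<open>C\<close>.
\<close>

lemma countable_subcover_compact_Diff_closed:
  fixes K C :: "'a::metric_space set"
  assumes "compact K" "closed C" "C \<noteq> {}"
    and W: "\<And>p. p \<in> K - C \<Longrightarrow> open (W p) \<and> p \<in> W p"
  obtains D where "countable D" "D \<subseteq> K - C" "K - C \<subseteq> (\<Union>p\<in>D. W p)"
proof -
  define L where "L n = K \<inter> {p. 1 / real (Suc n) \<le> infdist p C}" for n
  have "\<exists>D. finite D \<and> D \<subseteq> L n \<and> L n \<subseteq> (\<Union>p\<in>D. W p)" for n
  proof -
    have "closed {p. 1 / real (Suc n) \<le> infdist p C}"
      by (intro closed_Collect_le continuous_intros)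
    then have "compact (L n)"
      unfolding L_def using assms(1) by (rule compact_Int_closed[rotated])
    have "L n \<subseteq> K - C"
      by (auto simp: L_def)
    then have W': "open (W p)" "p \<in> W p" if "p \<in> L n" for p
      using W that by blast+
    obtain D where "D \<subseteq> L n" "finite D" "L n \<subseteq> (\<Union>p\<in>D. W p)"
      by (rule compactE_image[OF \<open>compact (L n)\<close>, of "L n" W]) (use W' in auto)
    then show ?thesis
      by (intro exI[of _ D] conjI)
  qed
  then obtain D where D: "\<And>n. finite (D n)" "\<And>n. D n \<subseteq> L n" "\<And>n. L n \<subseteq> (\<Union>p\<in>D n. W p)"
    by metis
  have cover: "K - C \<subseteq> (\<Union>n. L n)"
  proof
    fix p assume p: "p \<in> K - C"
    then have "infdist p C > 0"
      using assms(2,3) by (metis DiffD2 in_closed_iff_infdist_zero infdist_nonneg less_le)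
    then obtain n where "1 / real (Suc n) < infdist p C"
      using nat_approx_posE by blast
    with p have "p \<in> L n"
      by (simp add: L_def)
    then show "p \<in> (\<Union>n. L n)"
      by blast
  qed
  have L: "L n \<subseteq> K - C" for n
    by (auto simp: L_def)
  show thesis
  proof (rule that[of "\<Union>n. D n"])
    show "countable (\<Union>n. D n)"
      using D(1) by (intro countable_UN) (auto intro: countable_finite)
    show "(\<Union>n. D n) \<subseteq> K - C"
      using D(2) L by (intro UN_least) (meson order_trans)
    show "K - C \<subseteq> (\<Union>p\<in>(\<Union>n. D n). W p)"
    proof
      fix p assume "p \<in> K - C"
      with cover obtain n where "p \<in> L n"
        by (meson UN_E subsetD)
      then have "p \<in> (\<Union>p\<in>D n. W p)"
        by (rule subsetD[OF D(3)])
      then show "p \<in> (\<Union>p\<in>(\<Union>n. D n). W p)"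
        by blast
    qed
  qed
qed

text \<open>
  The witness is \<open>sup\<^sub>n min (1 / (n + 1)) (r\<^sub>n x y)\<close>: the shrinking truncations leave only finitely
  many \<open>r\<^sub>n\<close> to be controlled near a given point.
\<close>

lemma invariant_pseudometric_countable_Inter:
  fixes X :: "'a::metric_space set"
  assumes r: "\<And>n::nat. invariant_pseudometric X f (r n)"
  shows "\<exists>\<rho>. invariant_pseudometric X f \<rho> \<and> zero_set X \<rho> = (\<Inter>n. zero_set X (r n))"
proof -
  define s where "s n x y = min (1 / real (Suc n)) (r n x y)" for n x y
  define \<rho> where "\<rho> x y = (SUP n. s n x y)" for x y
  have cr: "continuous_pseudometric X (r n)" and pr: "pseudometric_on X (r n)" for n
    using r[of n] by (auto simp: invariant_pseudometric_def continuous_pseudometric_def)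
  have s: "pseudometric_on X (s n)" for n
    unfolding s_def using pr by (intro pseudometric_on_min) auto
  have le1: "s n x y \<le> 1" for n x y
    by (simp add: s_def min_le_iff_disj)
  have s_le: "s n x y \<le> \<rho> x y" for n x y
    unfolding \<rho>_def by (rule cSUP_upper) (auto intro!: bdd_aboveI2[where M=1] le1)
  have \<rho>: "pseudometric_on X \<rho>"
    unfolding \<rho>_def by (rule pseudometric_on_SUP[where B=1, OF s]) (rule le1)
  have "continuous_pseudometric X \<rho>"
    unfolding continuous_pseudometric_def
  proof (intro conjI ballI allI impI \<rho>)
    fix x and e :: real assume x: "x \<in> X" and "0 < e"
    then obtain N where N: "1 / real (Suc N) < e / 2"
      using nat_approx_posE[of "e / 2"] by auto
    have "\<forall>\<^sub>F y in at x within X. \<forall>n\<in>{..N}. r n x y < e / 2"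
      using cr x \<open>0 < e\<close> unfolding continuous_pseudometric_def
      by (intro eventually_ball_finite finite_atMost ballI) (meson half_gt_zero)
    then show "\<forall>\<^sub>F y in at x within X. \<rho> x y < e"
    proof eventually_elim
      case (elim y)
      have "s n x y \<le> e / 2" for n
      proof (cases "n \<le> N")
        case False
        then have "1 / real (Suc n) \<le> 1 / real (Suc N)"
          by (simp add: field_simps)
        then show ?thesis
          using N by (simp add: s_def min_le_iff_disj)
      qed (use elim in \<open>force simp: s_def min_le_iff_disj\<close>)
      then have "\<rho> x y \<le> e / 2"
        unfolding \<rho>_def by (intro cSUP_least) auto
      then show ?case
        using \<open>0 < e\<close> by simp
    qed
  qed
  then have "invariant_pseudometric X f \<rho>"
    using r by (auto simp: invariant_pseudometric_def \<rho>_def s_def)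
  moreover have "\<rho> x y = 0 \<longleftrightarrow> (\<forall>n. r n x y = 0)" if "x \<in> X" "y \<in> X" for x y
  proof
    assume 0: "\<rho> x y = 0"
    show "\<forall>n. r n x y = 0"
    proof
      fix n
      have "r n x y \<le> 0"
        using s_le[of n x y] 0 by (auto simp: s_def min_def split: if_splits)
      then show "r n x y = 0"
        using pseudometric_on_nonneg[OF pr that, of n] by simp
    qed
  qed (simp add: \<rho>_def s_def)
  ultimately show ?thesis
    by (intro exI[of _ \<rho>]) (auto simp: zero_set_def)
qed

text \<open>
  In particular, the least relation in the definition of \<open>S_eq\<close> exists.
\<close>

lemma S_eq_eq_zero_set:
  fixes X :: "'a::metric_space set"
  assumes X: "X \<noteq> {}" "compact X" "continuous_on X f" "f ` X = X"
  shows "\<exists>\<rho>. invariant_pseudometric X f \<rho> \<and> S_eq (top_of_set X) f = zero_set X \<rho> \<and>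
    (\<forall>\<sigma>. invariant_pseudometric X f \<sigma> \<longrightarrow> zero_set X \<rho> \<subseteq> zero_set X \<sigma>)"
proof -
  define F where "F = {\<sigma>. invariant_pseudometric X f \<sigma>}"
  define S where "S = (\<Inter>\<sigma>\<in>F. zero_set X \<sigma>)"
  have 0: "(\<lambda>_ _. 0) \<in> F"
    by (simp add: F_def invariant_pseudometric_def continuous_pseudometric_def pseudometric_on_def)
  have closed_zero: "closed (zero_set X \<sigma>)" if "\<sigma> \<in> F" for \<sigma>
  proof -
    have "closed (X \<times> X \<inter> (\<lambda>(x, y). \<sigma> x y) -` {0})"
      using that X(2) by (intro continuous_closed_preimage continuous_pseudometric_continuous_on)
        (auto simp: F_def invariant_pseudometric_def compact_imp_closed closed_Times)
    moreover have "X \<times> X \<inter> (\<lambda>(x, y). \<sigma> x y) -` {0} = zero_set X \<sigma>"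
      by (auto simp: zero_set_def)
    ultimately show ?thesis
      by simp
  qed
  have "closed S"
    unfolding S_def by (intro closed_INT ballI closed_zero)
  obtain x0 where "x0 \<in> X"
    using X(1) by blast
  then have "(x0, x0) \<in> S"
    by (auto simp: S_def F_def zero_set_def invariant_pseudometric_def continuous_pseudometric_def
        pseudometric_on_refl)
  then have "S \<noteq> {}"
    by blast
  have "\<exists>\<sigma>\<in>F. p \<notin> zero_set X \<sigma>" if "p \<in> X \<times> X - S" for p
    using that by (auto simp: S_def)
  then obtain \<sigma> where \<sigma>: "\<And>p. p \<in> X \<times> X - S \<Longrightarrow> \<sigma> p \<in> F \<and> p \<notin> zero_set X (\<sigma> p)"
    by metis
  obtain D where D: "countable D" "D \<subseteq> X \<times> X - S"
    "X \<times> X - S \<subseteq> (\<Union>p\<in>D. - zero_set X (\<sigma> p))"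
  proof (rule countable_subcover_compact_Diff_closed[of "X \<times> X" S "\<lambda>p. - zero_set X (\<sigma> p)"])
    show "open (- zero_set X (\<sigma> p)) \<and> p \<in> - zero_set X (\<sigma> p)" if "p \<in> X \<times> X - S" for p
      using \<sigma>[OF that] closed_zero by auto
  qed (use \<open>closed S\<close> \<open>S \<noteq> {}\<close> X(2) in \<open>auto simp: compact_Times\<close>)
  \<comment> \<open>The zero pseudometric is added so that the family can be enumerated even if \<open>D\<close> is empty.\<close>
  define E where "E = insert (\<lambda>_ _. 0) (\<sigma> ` D)"
  have E: "E \<noteq> {}" "countable E" "E \<subseteq> F"
    using D \<sigma> 0 by (auto simp: E_def)
  define r where "r = from_nat_into E"
  have r: "range r = E"
    using E by (simp add: r_def range_from_nat_into)
  then have "invariant_pseudometric X f (r n)" for n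
    using E(3) by (auto simp: F_def)
  then obtain \<rho> where \<rho>: "invariant_pseudometric X f \<rho>" "zero_set X \<rho> = (\<Inter>n. zero_set X (r n))"
    using invariant_pseudometric_countable_Inter[of X f r] by blast
  have "zero_set X \<rho> = (\<Inter>\<sigma>\<in>E. zero_set X \<sigma>)"
    unfolding \<rho>(2) r[symmetric] by simp
  also have "\<dots> \<subseteq> S"
  proof (rule subsetI, rule ccontr)
    fix p assume p: "p \<in> (\<Inter>\<sigma>\<in>E. zero_set X \<sigma>)" and "p \<notin> S"
    from p have "p \<in> X \<times> X"
      by (auto simp: E_def zero_set_def)
    with \<open>p \<notin> S\<close> have "p \<in> (\<Union>p\<in>D. - zero_set X (\<sigma> p))"
      by (intro subsetD[OF D(3)]) simp
    then obtain p' where "p' \<in> D" "p \<notin> zero_set X (\<sigma> p')"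
      by blast
    with p show False
      by (simp add: E_def)
  qed
  finally have "zero_set X \<rho> \<subseteq> S" .
  moreover have "S \<subseteq> zero_set X \<sigma>" if "invariant_pseudometric X f \<sigma>" for \<sigma>
    unfolding S_def by (rule INT_lower) (simp add: F_def that)
  ultimately have least: "zero_set X \<rho> \<subseteq> zero_set X \<sigma>" if "invariant_pseudometric X f \<sigma>" for \<sigma>
    using that by (meson order_trans)
  have "S_eq (top_of_set X) f = zero_set X \<rho>"
    unfolding S_eq_def
  proof (rule Least_equality)
    show "closed_invariant_equiv (top_of_set X) f (zero_set X \<rho>) \<and>
      equicontinuous_system (quotient_topology (top_of_set X) (zero_set X \<rho>))
        (induced_map (zero_set X \<rho>) f)"
      using invariant_pseudometric_equicontinuous_quotient[OF X(2-4) \<rho>(1)] by blast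
  next
    fix R assume R: "closed_invariant_equiv (top_of_set X) f R \<and>
      equicontinuous_system (quotient_topology (top_of_set X) R) (induced_map R f)"
    have "factor_map (top_of_set X) f (quotient_topology (top_of_set X) R) (induced_map R f)
      (\<lambda>x. R `` {x})"
      by (rule factor_map_quotient) (use R X in auto)
    then obtain \<tau> where \<tau>: "invariant_pseudometric X f \<tau>"
      "zero_set X \<tau> = {(x, y). x \<in> X \<and> y \<in> X \<and> R `` {x} = R `` {y}}"
      using equicontinuous_factor_imp_invariant_pseudometric[OF X(2,4)] R by blast
    have "equiv X R"
      using R by (simp add: closed_invariant_equiv_def)
    then have "zero_set X \<tau> \<subseteq> R"
      unfolding \<tau>(2) using eq_equiv_class[of R _ _ X] by blast
    then show "zero_set X \<rho> \<subseteq> R"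
      using least[OF \<tau>(1)] by blast
  qed
  with \<rho>(1) show ?thesis
    by (intro exI[of _ \<rho>] conjI allI impI least)
qed

section \<open>Diameters of connected sets joining two points\<close>

text \<open>
  The infimum of the \<open>\<rho>\<close>-diameters of the connected subsets of \<open>X\<close> containing \<open>x\<close> and \<open>y\<close>, written as
  an infimum of bounds for such diameters. There is such a bound whenever \<open>X\<close> is compact and connected
  and \<open>\<rho>\<close> is continuous, since \<open>X\<close> itself is then a competitor.
\<close>

definition connected_size :: "'a::topological_space set \<Rightarrow> ('a \<Rightarrow> 'a \<Rightarrow> real) \<Rightarrow> 'a \<Rightarrow> 'a \<Rightarrow> real" where
  "connected_size X \<rho> x y =
     Inf {c. \<exists>C\<subseteq>X. connected C \<and> x \<in> C \<and> y \<in> C \<and> (\<forall>u\<in>C. \<forall>v\<in>C. \<rho> u v \<le> c)}"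

lemma connected_size_le:
  assumes \<rho>: "pseudometric_on X \<rho>"
    and "C \<subseteq> X" "connected C" "x \<in> C" "y \<in> C" "\<And>u v. u \<in> C \<Longrightarrow> v \<in> C \<Longrightarrow> \<rho> u v \<le> c"
  shows "connected_size X \<rho> x y \<le> c"
  unfolding connected_size_def
proof (rule cInf_lower)
  have "\<rho> x x = 0"
    using pseudometric_on_refl[OF \<rho>] assms(2,4) by blast
  then have "0 \<le> c" if "\<exists>C\<subseteq>X. connected C \<and> x \<in> C \<and> y \<in> C \<and> (\<forall>u\<in>C. \<forall>v\<in>C. \<rho> u v \<le> c)" for c
    using that by metis
  then show "bdd_below {c. \<exists>C\<subseteq>X. connected C \<and> x \<in> C \<and> y \<in> C \<and> (\<forall>u\<in>C. \<forall>v\<in>C. \<rho> u v \<le> c)}"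
    by (intro bdd_belowI[of _ 0]) simp
  show "c \<in> {c. \<exists>C\<subseteq>X. connected C \<and> x \<in> C \<and> y \<in> C \<and> (\<forall>u\<in>C. \<forall>v\<in>C. \<rho> u v \<le> c)}"
    using assms(2-6) by (intro CollectI exI[of _ C]) simp
qed

lemma connected_size_less:
  assumes X: "compact X" "connected X" and \<rho>: "continuous_pseudometric X \<rho>"
    and "x \<in> X" "y \<in> X" "connected_size X \<rho> x y < e"
  obtains C c where "C \<subseteq> X" "connected C" "x \<in> C" "y \<in> C"
    "\<And>u v. u \<in> C \<Longrightarrow> v \<in> C \<Longrightarrow> \<rho> u v \<le> c" "c < e"
proof -
  let ?A = "{c. \<exists>C\<subseteq>X. connected C \<and> x \<in> C \<and> y \<in> C \<and> (\<forall>u\<in>C. \<forall>v\<in>C. \<rho> u v \<le> c)}"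
  have "compact ((\<lambda>(x, y). \<rho> x y) ` (X \<times> X))"
    using X(1) \<rho> by (intro compact_continuous_image continuous_pseudometric_continuous_on compact_Times)
  then obtain B where "\<And>z. z \<in> (\<lambda>(x, y). \<rho> x y) ` (X \<times> X) \<Longrightarrow> z \<le> B"
    by (meson bdd_above_def bounded_imp_bdd_above compact_imp_bounded)
  then have "\<rho> u v \<le> B" if "u \<in> X" "v \<in> X" for u v
    using that by force
  then have "B \<in> ?A"
    using X(2) assms(4,5) by (intro CollectI exI[of _ X]) simp
  then obtain c where c: "c \<in> ?A" "c < e"
    using cInf_lessD[of ?A e] assms(6) unfolding connected_size_def by blast
  from c(1) obtain C where "C \<subseteq> X" "connected C" "x \<in> C" "y \<in> C" "\<forall>u\<in>C. \<forall>v\<in>C. \<rho> u v \<le> c"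
    by (elim CollectE exE conjE)
  with c(2) show thesis
    by (intro that[of C c]) simp_all
qed

lemma invariant_pseudometric_connected_size:
  fixes X :: "'a::metric_space set"
  assumes X: "compact X" "connected X" "locally connected X" "continuous_on X f" "f ` X = X"
    and inv: "invariant_pseudometric X f \<rho>"
  shows "invariant_pseudometric X f (connected_size X \<rho>)"
proof -
  let ?\<sigma> = "connected_size X \<rho>"
  have cp: "continuous_pseudometric X \<rho>" and iso: "\<And>x y. x \<in> X \<Longrightarrow> y \<in> X \<Longrightarrow> \<rho> (f x) (f y) = \<rho> x y"
    using inv by (auto simp: invariant_pseudometric_def)
  then have \<rho>: "pseudometric_on X \<rho>"
    by (simp add: continuous_pseudometric_def)
  have nonneg: "0 \<le> ?\<sigma> x y" if "x \<in> X" "y \<in> X" for x y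
  proof (rule ccontr)
    assume "\<not> 0 \<le> ?\<sigma> x y"
    then have "?\<sigma> x y < 0"
      by simp
    then obtain C c where "x \<in> C" "\<And>u v. u \<in> C \<Longrightarrow> v \<in> C \<Longrightarrow> \<rho> u v \<le> c" "c < 0"
      using connected_size_less[OF X(1,2) cp \<open>x \<in> X\<close> \<open>y \<in> X\<close>] by metis
    then have "\<rho> x x < 0"
      by force
    then show False
      using pseudometric_on_refl[OF \<rho> \<open>x \<in> X\<close>] by simp
  qed
  have \<sigma>: "pseudometric_on X ?\<sigma>"
    unfolding pseudometric_on_def
  proof (intro conjI ballI)
    fix x assume x: "x \<in> X"
    have "?\<sigma> x x \<le> 0"
      by (rule connected_size_le[OF \<rho>, of "{x}"]) (use x pseudometric_on_refl[OF \<rho> x] in auto)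
    then show "?\<sigma> x x = 0"
      using nonneg[OF x x] by simp
  next
    fix x y assume "x \<in> X" "y \<in> X"
    show "?\<sigma> x y = ?\<sigma> y x"
      unfolding connected_size_def by (rule arg_cong[where f=Inf]) blast
  next
    fix x y z assume x: "x \<in> X" and y: "y \<in> X" and z: "z \<in> X"
    show "?\<sigma> x z \<le> ?\<sigma> x y + ?\<sigma> y z"
    proof (rule field_le_epsilon)
      fix e :: real assume "0 < e"
      obtain C c where C: "C \<subseteq> X" "connected C" "x \<in> C" "y \<in> C"
        "\<And>u v. u \<in> C \<Longrightarrow> v \<in> C \<Longrightarrow> \<rho> u v \<le> c" "c < ?\<sigma> x y + e / 2"
        using connected_size_less[OF X(1,2) cp x y, of "?\<sigma> x y + e / 2"] \<open>0 < e\<close> by auto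
      obtain C' c' where C': "C' \<subseteq> X" "connected C'" "y \<in> C'" "z \<in> C'"
        "\<And>u v. u \<in> C' \<Longrightarrow> v \<in> C' \<Longrightarrow> \<rho> u v \<le> c'" "c' < ?\<sigma> y z + e / 2"
        using connected_size_less[OF X(1,2) cp y z, of "?\<sigma> y z + e / 2"] \<open>0 < e\<close> by auto
      have "connected (C \<union> C')"
        using C C' by (intro connected_Un) auto
      moreover have cross: "\<rho> u v \<le> c + c'" if "u \<in> C" "v \<in> C'" for u v
        using pseudometric_on_triangle[OF \<rho>, of u y v] C C' that y by (meson add_mono order_trans subsetD)
      have "0 \<le> c" "0 \<le> c'"
        using C(5)[OF C(3) C(3)] C'(5)[OF C'(3) C'(3)] pseudometric_on_refl[OF \<rho>] x y by auto
      have "\<rho> u v \<le> c + c'" if uv: "u \<in> C \<union> C'" "v \<in> C \<union> C'" for u v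
      proof -
        consider "u \<in> C" "v \<in> C" | "u \<in> C'" "v \<in> C'" | "u \<in> C" "v \<in> C'" | "v \<in> C" "u \<in> C'"
          using uv by blast
        then show ?thesis
        proof cases
          case 1
          then show ?thesis using C(5)[of u v] \<open>0 \<le> c'\<close> by simp
        next
          case 2
          then show ?thesis using C'(5)[of u v] \<open>0 \<le> c\<close> by simp
        next
          case 3
          then show ?thesis by (rule cross)
        next
          case 4
          then show ?thesis
            using cross[of v u] pseudometric_on_sym[OF \<rho>, of u v] subsetD[OF C(1)] subsetD[OF C'(1)] by simp
        qed
      qed
      ultimately have "?\<sigma> x z \<le> c + c'"
        using C C' by (intro connected_size_le[OF \<rho>, of "C \<union> C'"]) auto
      then show "?\<sigma> x z \<le> ?\<sigma> x y + ?\<sigma> y z + e"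
        using C(6) C'(6) by simp
    qed
  qed
  have "continuous_pseudometric X ?\<sigma>"
  proof (rule continuous_pseudometricI[OF \<sigma>])
    fix x and e :: real assume x: "x \<in> X" and "0 < e"
    then obtain \<delta> where "\<delta> > 0" and \<delta>: "\<And>y. y \<in> X \<Longrightarrow> dist y x < \<delta> \<Longrightarrow> \<rho> x y < e / 4"
      using continuous_pseudometricD[OF cp, of x "e / 4"] by auto
    have "openin (top_of_set X) (X \<inter> ball x \<delta>)" "x \<in> X \<inter> ball x \<delta>"
      using x \<open>\<delta> > 0\<close> by auto
    then obtain U where U: "openin (top_of_set X) U" "connected U" "x \<in> U" "U \<subseteq> X \<inter> ball x \<delta>"
      using X(3) unfolding locally_connected by blast
    have "\<rho> u v \<le> e / 2" if "u \<in> U" "v \<in> U" for u v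
    proof -
      have uv: "u \<in> X" "v \<in> X" "\<rho> x u < e / 4" "\<rho> x v < e / 4"
        using that U(4) \<delta> by (auto simp: dist_commute subset_iff)
      then show ?thesis
        using pseudometric_on_triangle[OF \<rho> uv(1) x uv(2)] pseudometric_on_sym[OF \<rho> x uv(1)] by linarith
    qed
    then have "?\<sigma> x y \<le> e / 2" if "y \<in> U" for y
      using U that by (intro connected_size_le[OF \<rho>, of U]) auto
    then show "\<exists>U. openin (top_of_set X) U \<and> x \<in> U \<and> (\<forall>y\<in>U. ?\<sigma> x y < e)"
      using U \<open>0 < e\<close> by (intro exI[of _ U]) force
  qed
  moreover have "?\<sigma> (f x) (f y) \<le> ?\<sigma> x y" if xy: "x \<in> X" "y \<in> X" for x y
  proof (rule field_le_epsilon)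
    fix e :: real assume "0 < e"
    then obtain C c where C: "C \<subseteq> X" "connected C" "x \<in> C" "y \<in> C"
      "\<And>u v. u \<in> C \<Longrightarrow> v \<in> C \<Longrightarrow> \<rho> u v \<le> c" "c < ?\<sigma> x y + e"
      using connected_size_less[OF X(1,2) cp xy, of "?\<sigma> x y + e"] by auto
    have "connected (f ` C)"
      using C X(4) by (intro connected_continuous_image) (auto intro: continuous_on_subset)
    moreover have "f ` C \<subseteq> X"
      using C(1) X(5) by blast
    moreover have "\<rho> (f u) (f v) \<le> c" if "u \<in> C" "v \<in> C" for u v
      using C(5)[OF that] iso[of u v] subsetD[OF C(1)] that by simp
    ultimately have "?\<sigma> (f x) (f y) \<le> c"
      using C(3,4) by (intro connected_size_le[OF \<rho>, of "f ` C"]) auto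
    then show "?\<sigma> (f x) (f y) \<le> ?\<sigma> x y + e"
      using C(6) by simp
  qed
  ultimately show ?thesis
    using nonexpansive_surj_imp_invariant[OF X(1,5)] by blast
qed

text \<open>
  The inclusion of zero sets says that points at \<open>\<rho>\<close>-distance zero are joined by connected sets of arbitrarily
  small \<open>\<rho>\<close>-diameter.
\<close>

lemma connected_zero_set_class:
  fixes X :: "'a::metric_space set"
  assumes X: "compact X" "connected X" and cp: "continuous_pseudometric X \<rho>"
    and sub: "zero_set X \<rho> \<subseteq> zero_set X (connected_size X \<rho>)" and x: "x \<in> X"
  shows "connected (zero_set X \<rho> `` {x})"
proof (rule ccontr)
  let ?K = "zero_set X \<rho> `` {x}"
  assume nc: "\<not> connected ?K"
  have \<rho>: "pseudometric_on X \<rho>"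
    using cp by (simp add: continuous_pseudometric_def)
  have cont: "continuous_on X (\<rho> x)"
    using continuous_on_compose2[OF continuous_pseudometric_continuous_on[OF cp], of X "\<lambda>y. (x, y)"] x
    by (simp add: continuous_on_Pair continuous_on_const continuous_on_id image_subset_iff)
  have "closed (X \<inter> \<rho> x -` {0})"
    using X(1) cont by (intro continuous_closed_preimage) (auto simp: compact_imp_closed)
  moreover have K: "?K = X \<inter> \<rho> x -` {0}"
    using x by (auto simp: zero_set_def)
  ultimately have "closed ?K"
    by simp
  then obtain A B where AB: "closed A" "closed B" "A \<noteq> {}" "B \<noteq> {}" "A \<union> B = ?K" "A \<inter> B = {}"
    using nc by (auto simp: connected_closed_set)
  obtain a b where a: "a \<in> A" and b: "b \<in> B"
    using AB by blast
  obtain U V where UV: "open U" "open V" "A \<subseteq> U" "B \<subseteq> V" "U \<inter> V = {}"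
    using t4_space[OF AB(1,2,6)] by blast
  have "compact (X - (U \<union> V))"
    using X(1) UV by (intro compact_diff open_Un)
  moreover have "continuous_on (X - (U \<union> V)) (\<rho> x)"
    using cont by (rule continuous_on_subset) auto
  \<comment> \<open>The class of \<open>x\<close> lies in \<open>U \<union> V\<close>, so off \<open>U \<union> V\<close> the distance to \<open>x\<close> has a positive lower bound.\<close>
  ultimately obtain e where "e > 0" and e: "\<And>y. y \<in> X - (U \<union> V) \<Longrightarrow> e \<le> \<rho> x y"
  proof (cases "X - (U \<union> V) = {}")
    case False
    then obtain z where z: "z \<in> X - (U \<union> V)" "\<And>y. y \<in> X - (U \<union> V) \<Longrightarrow> \<rho> x z \<le> \<rho> x y"
      using continuous_attains_inf[of "X - (U \<union> V)" "\<rho> x"] \<open>compact (X - (U \<union> V))\<close>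
        \<open>continuous_on (X - (U \<union> V)) (\<rho> x)\<close> by blast
    moreover have "z \<notin> ?K"
      using z(1) AB UV by blast
    then have "\<rho> x z > 0"
      using z(1) pseudometric_on_nonneg[OF \<rho> x, of z] by (auto simp: K less_le)
    ultimately show ?thesis
      using that by blast
  qed (use that[of 1] in auto)
  have ab: "a \<in> ?K" "b \<in> ?K" "a \<in> X" "b \<in> X"
    using a b AB(5) K by blast+
  have equ: "equiv X (zero_set X \<rho>)"
    by (rule equiv_zero_set[OF \<rho>])
  have "(a, b) \<in> zero_set X \<rho>"
    using ab equ by (meson Image_singleton_iff equiv_def symD transD)
  then have "connected_size X \<rho> a b < e"
    using sub \<open>e > 0\<close> by (auto simp: zero_set_def)
  then obtain C c where C: "C \<subseteq> X" "connected C" "a \<in> C" "b \<in> C"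
    "\<And>u v. u \<in> C \<Longrightarrow> v \<in> C \<Longrightarrow> \<rho> u v \<le> c" "c < e"
    using connected_size_less[OF X cp ab(3,4)] by metis
  have "C \<subseteq> U \<union> V"
  proof
    fix v assume v: "v \<in> C"
    have "\<rho> x v \<le> \<rho> x a + \<rho> a v"
      using pseudometric_on_triangle[OF \<rho> x ab(3)] v C(1) by blast
    also have "\<rho> x a = 0"
      using ab(1) by (simp add: K)
    finally show "v \<in> U \<union> V"
      using C(5)[OF C(3) v] C(6) e[of v] v C(1) by force
  qed
  moreover have "U \<inter> C \<noteq> {}" "V \<inter> C \<noteq> {}"
    using a b C UV by blast+
  ultimately show False
    using connectedD[OF C(2) UV(1,2)] UV(5) by blast
qed

section \<open>The maximal equicontinuous factor\<close>

text \<open>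
  The quotient map is closed, and for closed maps connectedness of the fibres passes to the preimages
  of all connected sets.
\<close>

lemma monotone_mapping_quotient:
  assumes T: "compact_space T" and R: "equiv (topspace T) R"
    and Q: "Hausdorff_space (quotient_topology T R)"
    and conn: "\<And>x. x \<in> topspace T \<Longrightarrow> connectedin T (R `` {x})"
  shows "monotone_mapping T (quotient_topology T R) (\<lambda>x. R `` {x})"
proof -
  let ?Q = "quotient_topology T R" and ?q = "\<lambda>x. R `` {x}"
  have q: "continuous_map T ?Q ?q" "?q ` topspace T = topspace ?Q"
    using quotient_map_quotient_topology[of T R]
    by (auto simp: quotient_imp_continuous_map quotient_imp_surjective_map)
  have "closed_map T ?Q ?q"
    by (rule T1_Spaces.continuous_imp_closed_map[OF q(1) T Q])
  moreover have "monotone_map T ?Q ?q"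
    unfolding monotone_map_def
  proof (intro conjI ballI)
    fix P assume "P \<in> topspace ?Q"
    then obtain x where x: "x \<in> topspace T" "P = ?q x"
      using q(2) by auto
    have "{y \<in> topspace T. ?q y = P} = ?q x"
      using eq_equiv_class_iff[OF R _ x(1)] equiv_class_eq_iff[OF R] x by blast
    then show "connectedin T {y \<in> topspace T. ?q y = P}"
      using conn[OF x(1)] by simp
  qed (use q in auto)
  ultimately show ?thesis
    using monotone_closed_map[OF q(1) _ q(2)] by (simp add: monotone_mapping_def)
qed

theorem theorem3p3:
  fixes X :: "'a::metric_space set" and f :: "'a \<Rightarrow> 'a"
  assumes "X \<noteq> {}" and "compact X" and "connected X"
    and "locally connected X"
    and "continuous_on X f" and "f ` X = X"
  defines "T \<equiv> top_of_set X"
  defines "S \<equiv> S_eq T f"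
  shows "(\<forall>x\<in>X. connected (S `` {x})) \<and>
    maximal_equicontinuous_factor TYPE('c) T f (quotient_topology T S) (induced_map S f) \<and>
    (\<exists>\<pi>. factor_map T f (quotient_topology T S) (induced_map S f) \<pi> \<and>
         monotone_mapping T (quotient_topology T S) \<pi>)"
proof -
  obtain \<rho> where inv: "invariant_pseudometric X f \<rho>" and S: "S = zero_set X \<rho>"
    and least: "\<And>\<sigma>. invariant_pseudometric X f \<sigma> \<Longrightarrow> S \<subseteq> zero_set X \<sigma>"
    using S_eq_eq_zero_set[OF assms(1,2,5,6)] unfolding S_def T_def by metis
  have cp: "continuous_pseudometric X \<rho>"
    using inv by (simp add: invariant_pseudometric_def)
  have "S \<subseteq> zero_set X (connected_size X \<rho>)"
    by (intro least invariant_pseudometric_connected_size assms inv)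
  then have conn: "connected (S `` {x})" if "x \<in> X" for x
    using connected_zero_set_class[OF assms(2,3) cp _ that] by (simp add: S)
  let ?Q = "quotient_topology T S" and ?g = "induced_map S f" and ?q = "\<lambda>x. S `` {x}"
  have ci: "closed_invariant_equiv T f S" and eq: "equicontinuous_system ?Q ?g"
    using invariant_pseudometric_equicontinuous_quotient[OF assms(2,5,6) inv] by (auto simp: T_def S)
  have fac: "factor_map T f ?Q ?g ?q"
    by (rule factor_map_quotient[OF ci])
  have ds: "dynamical_system ?Q ?g"
    using eq by (simp add: equicontinuous_system_def)
  have "is_factor ?Q ?g V h" if V: "is_factor T f V h" "equicontinuous_system V h"
    for V :: "'c topology" and h
  proof -
    obtain \<pi> where \<pi>: "factor_map T f V h \<pi>"
      using V(1) by (auto simp: is_factor_def)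
    obtain \<sigma> where "invariant_pseudometric X f \<sigma>"
      and \<sigma>: "zero_set X \<sigma> = {(x, y). x \<in> X \<and> y \<in> X \<and> \<pi> x = \<pi> y}"
      using equicontinuous_factor_imp_invariant_pseudometric[OF assms(2,6) \<pi>[unfolded T_def] V(2)]
      by blast
    then have le: "S \<subseteq> zero_set X \<sigma>"
      using least by blast
    have "\<pi> x = \<pi> y" if "x \<in> topspace T" "y \<in> topspace T" "?q x = ?q y" for x y
    proof -
      have "(x, y) \<in> S"
        using ci that by (auto simp: closed_invariant_equiv_def eq_equiv_class_iff)
      then show ?thesis
        using le by (auto simp: \<sigma>)
    qed
    \<comment> \<open>So \<open>\<pi>\<close> is constant on the classes of \<open>S\<close> and factors through the quotient.\<close>
    then obtain \<pi>' where \<pi>': "continuous_map ?Q V \<pi>'" "\<pi>' ` topspace ?Q = \<pi> ` topspace T"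
      "\<And>x. x \<in> topspace T \<Longrightarrow> \<pi>' (?q x) = \<pi> x"
      using quotient_map_lift_exists[OF quotient_map_quotient_topology, of T V \<pi> S] \<pi>
      unfolding factor_map_def by metis
    have "\<pi>' (?g P) = h (\<pi>' P)" if P: "P \<in> topspace ?Q" for P
    proof -
      obtain x where x: "x \<in> topspace T" "P = ?q x"
        using P by (auto simp: topspace_quotient_topology quotient_def)
      moreover have "f x \<in> topspace T"
        using x assms(6) by (auto simp: T_def)
      ultimately show ?thesis
        using \<pi>' \<pi> induced_map_class[OF ci x(1)] by (simp add: factor_map_def)
    qed
    then have "factor_map ?Q ?g V h \<pi>'"
      using \<pi>' \<pi> by (simp add: factor_map_def)
    then show ?thesis
      using V by (auto simp: is_factor_def)
  qed
  then have "maximal_equicontinuous_factor TYPE('c) T f ?Q ?g"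
    using eq ds fac by (auto simp: maximal_equicontinuous_factor_def is_factor_def)
  moreover have "monotone_mapping T ?Q ?q"
  proof (rule monotone_mapping_quotient)
    show "compact_space T"
      using assms(2) by (simp add: T_def compact_space_subtopology)
    show "Hausdorff_space ?Q"
      using ds by (simp add: dynamical_system_def metrizable_imp_Hausdorff_space)
    show "equiv (topspace T) S"
      using ci by (simp add: closed_invariant_equiv_def)
    show "connectedin T (S `` {x})" if "x \<in> topspace T" for x
      using conn[of x] that by (auto simp: T_def S connectedin_subtopology zero_set_def)
  qed
  ultimately show ?thesis
    using conn fac by blast
qed

end
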